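(* Let $n>3$ and let $Y$ be a generalized truncation of the complete graph $K_n$ in which every constituent graph is Hamilton-connected. Then $Y$ is Hamilton-connected.
   Context: Generalized truncation of a graph $X$: take a matching $M_0$ with $|M_0|=|E(X)|$ (on $2|E(X)|$ new vertices) and a bijection $F:E(X)\to M_0$; for each edge $e$ of $X$ with ends $u,v$, label one end of $F(e)$ by $u$ and the other by $v$. For $v\in V(X)$, the cluster $\mathrm{cl}(v)$ is the set of vertices labelled $v$; insert an arbitrary graph $\mathrm{con}(v)$ (the constituent at $v$) on $\mathrm{cl}(v)$. The result $F(M_0)\cup\bigcup_v\mathrm{con}(v)$ is a generalized truncation of $X$. A graph is Hamilton-connected if for every pair of distinct vertices there is a Hamilton path with those two vertices as its ends. *)

theory Defs
  imports Main
begin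

text \<open>Finite simple undirected graphs; an edge with ends u, v is the two-element set {u, v}.\<close>

record 'a ugraph =
  verts :: "'a set"
  edges :: "'a set set"

definition simple_graph :: "'a ugraph \<Rightarrow> bool" where
  "simple_graph G \<longleftrightarrow> finite (verts G) \<and> (\<forall>e\<in>edges G. e \<subseteq> verts G \<and> card e = 2)"

definition complete_graph :: "nat \<Rightarrow> 'a ugraph \<Rightarrow> bool" where
  "complete_graph n G \<longleftrightarrow> finite (verts G) \<and> card (verts G) = n \<and>
     edges G = {e. e \<subseteq> verts G \<and> card e = 2}"

definition hamilton_path :: "'a ugraph \<Rightarrow> 'a \<Rightarrow> 'a list \<Rightarrow> 'a \<Rightarrow> bool" where
  "hamilton_path G u p v \<longleftrightarrow> p \<noteq> [] \<and> hd p = u \<and> last p = v \<and>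
     distinct p \<and> set p = verts G \<and> successively (\<lambda>x y. {x, y} \<in> edges G) p"

definition hamilton_connected :: "'a ugraph \<Rightarrow> bool" where
  "hamilton_connected G \<longleftrightarrow>
     (\<forall>u\<in>verts G. \<forall>v\<in>verts G. u \<noteq> v \<longrightarrow> (\<exists>p. hamilton_path G u p v))"

definition matching :: "'b set set \<Rightarrow> bool" where
  "matching M \<longleftrightarrow> finite M \<and> (\<forall>e\<in>M. card e = 2) \<and> pairwise disjnt M"

definition cluster :: "'b set set \<Rightarrow> ('b \<Rightarrow> 'a) \<Rightarrow> 'a \<Rightarrow> 'b set" where
  "cluster M lab v = {x \<in> \<Union>M. lab x = v}"

text \<open>
  \<open>Y\<close> is the generalized truncation of \<open>X\<close> determined by the matching \<open>M\<close>, the bijection \<open>F\<close>,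
  the vertex labelling \<open>lab\<close> (relevant on \<open>\<Union>M\<close> only) and the constituents \<open>con v\<close> (relevant for
  vertices \<open>v\<close> of \<open>X\<close> only).
\<close>

definition generalized_truncation ::
  "'a ugraph \<Rightarrow> 'b set set \<Rightarrow> ('a set \<Rightarrow> 'b set) \<Rightarrow> ('b \<Rightarrow> 'a) \<Rightarrow> ('a \<Rightarrow> 'b ugraph) \<Rightarrow> 'b ugraph \<Rightarrow> bool"
where
  "generalized_truncation X M F lab con Y \<longleftrightarrow>
     simple_graph X \<and>
     matching M \<and> card M = card (edges X) \<and> bij_betw F (edges X) M \<and>
     (\<forall>u v. {u, v} \<in> edges X \<longrightarrow> (\<exists>x y. F {u, v} = {x, y} \<and> lab x = u \<and> lab y = v)) \<and>
     (\<forall>v\<in>verts X. simple_graph (con v) \<and> verts (con v) = cluster M lab v) \<and>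
     Y = \<lparr>verts = \<Union>M, edges = M \<union> (\<Union>v\<in>verts X. edges (con v))\<rparr>"

end

theory Submission
  imports Defs
begin

text \<open>
  Write \<open>\<phi> u v\<close> for the end labelled \<open>u\<close> of the matching edge \<open>F {u, v}\<close>. A path \<open>w\<^sub>1, \<dots>, w\<^sub>k\<close>
  in \<open>K\<^sub>n\<close> lifts to a path of \<open>Y\<close> that traverses the clusters of the \<open>w\<^sub>i\<close> one after the other, from
  \<open>\<phi> w\<^sub>1 a\<close> to \<open>\<phi> w\<^sub>k b\<close>, as long as it enters and leaves each cluster at different vertices.
  To join \<open>\<phi> u a\<close> to \<open>\<phi> v b\<close> where \<open>u \<noteq> v\<close> and \<open>a \<noteq> b\<close>, lift a Hamilton path of \<open>K\<^sub>n\<close> from \<open>u\<close> to \<open>v\<close>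
  whose second vertex is not \<open>a\<close> and whose last but one vertex is not \<open>b\<close>.
  If \<open>u = v\<close> or \<open>a = b\<close>, the cluster of \<open>u\<close> is visited twice: take a Hamilton path of \<open>con u\<close> starting at
  \<open>\<phi> u a\<close> and ending at \<open>\<phi> u b\<close> (if \<open>u = v\<close>) or at \<open>\<phi> u v\<close> (if \<open>a = b\<close>), and replace its first edge,
  which leads to \<open>\<phi> u c\<close> say, by an excursion from \<open>\<phi> u a\<close> over \<open>\<phi> a u\<close> through all other
  clusters (except that of \<open>v\<close>) to \<open>\<phi> c u\<close> and \<open>\<phi> u c\<close>.
\<close>

section \<open>Composing and splitting Hamilton paths\<close>

lemma hamilton_path_append:
  assumes "hamilton_path \<lparr>verts = A, edges = E\<rparr> u p v"
    and "hamilton_path \<lparr>verts = B, edges = E\<rparr> u' q v'"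
    and "{v, u'} \<in> E" and "A \<inter> B = {}"
  shows "hamilton_path \<lparr>verts = A \<union> B, edges = E\<rparr> u (p @ q) v'"
  using assms by (auto simp: hamilton_path_def successively_append_iff)

lemma hamilton_path_mono:
  assumes "hamilton_path G u p v" and "edges G \<subseteq> E"
  shows "hamilton_path \<lparr>verts = verts G, edges = E\<rparr> u p v"
  using assms by (auto simp: hamilton_path_def intro: successively_mono)

lemma hamilton_path_singleton: "hamilton_path \<lparr>verts = {u}, edges = E\<rparr> u [u] u"
  by (simp add: hamilton_path_def)

lemma hamilton_path_Cons_cases:
  assumes "hamilton_path \<lparr>verts = A, edges = E\<rparr> u p v" and "u \<noteq> v"
  obtains x q where "p = u # q" "x \<in> A" "x \<noteq> u"
    "hamilton_path \<lparr>verts = A - {u}, edges = E\<rparr> x q v"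
proof -
  obtain q where p: "p = u # q"
    using assms by (cases p) (auto simp: hamilton_path_def)
  with assms have "q \<noteq> []"
    by (auto simp: hamilton_path_def)
  with p assms have "hamilton_path \<lparr>verts = A - {u}, edges = E\<rparr> (hd q) q v"
    by (auto simp: hamilton_path_def successively_Cons)
  moreover have "hd q \<in> A" "hd q \<noteq> u"
    using p assms \<open>q \<noteq> []\<close> by (auto simp: hamilton_path_def)
  ultimately show thesis
    using p that by blast
qed

lemma finite_distinct_list_ends:
  assumes "finite S" "x \<in> S" "y \<in> S" "x \<noteq> y"
  obtains zs where "distinct (x # zs @ [y])" "set (x # zs @ [y]) = S"
proof -
  obtain zs where "distinct zs" "set zs = S - {x, y}"
    using finite_distinct_list[of "S - {x, y}"] assms(1) by auto
  then show thesis
    using assms by (intro that[of zs]) auto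
qed

section \<open>Lifting paths of the complete graph\<close>

text \<open>Retains only what the path constructions need from a truncation of the complete graph on
  \<open>V\<close>; \<open>port u v\<close> is the vertex \<open>\<phi> u v\<close>. A single edge
  set \<open>E\<close> serves all clusters, so that their paths can be concatenated.\<close>

locale linked_clusters =
  fixes V :: "'a set" and E :: "'b set set" and port :: "'a \<Rightarrow> 'a \<Rightarrow> 'b"
  assumes finite_V: "finite V"
    and port_eq_iff: "\<lbrakk>u \<in> V; v \<in> V; u \<noteq> v; u' \<in> V; v' \<in> V; u' \<noteq> v'\<rbrakk> \<Longrightarrow>
      port u v = port u' v' \<longleftrightarrow> u = u' \<and> v = v'"
    and link: "\<lbrakk>u \<in> V; v \<in> V; u \<noteq> v\<rbrakk> \<Longrightarrow> {port u v, port v u} \<in> E"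
    and cluster_path: "\<lbrakk>u \<in> V; a \<in> V - {u}; b \<in> V - {u}; a \<noteq> b\<rbrakk> \<Longrightarrow>
      \<exists>p. hamilton_path \<lparr>verts = port u ` (V - {u}), edges = E\<rparr> (port u a) p (port u b)"
begin

definition cl :: "'a \<Rightarrow> 'b set" where
  "cl u = port u ` (V - {u})"

abbreviation spans :: "'b set \<Rightarrow> 'b \<Rightarrow> 'b list \<Rightarrow> 'b \<Rightarrow> bool" where
  "spans A \<equiv> hamilton_path \<lparr>verts = A, edges = E\<rparr>"

lemma cl_disjoint:
  assumes "u \<in> V" "v \<in> V" "u \<noteq> v"
  shows "cl u \<inter> cl v = {}"
proof -
  have "port u a \<noteq> port v b" if "a \<in> V - {u}" "b \<in> V - {v}" for a b
    using port_eq_iff[of u a v b] assms that by auto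
  then show ?thesis
    unfolding cl_def by blast
qed

lemma cl_Union_disjoint:
  assumes "A \<subseteq> V" "B \<subseteq> V" "A \<inter> B = {}"
  shows "\<Union>(cl ` A) \<inter> \<Union>(cl ` B) = {}"
  using assms cl_disjoint by blast

text \<open>The last two assumptions concern the second and the last but one vertex of
  \<open>ws\<close>; if \<open>ws\<close> is a singleton, they default to \<open>b\<close> and
  \<open>a\<close>, and both say \<open>a \<noteq> b\<close>. Inner clusters need no condition,
  because \<open>ws\<close> is distinct.\<close>

lemma lift_path:
  assumes "ws \<noteq> []" "distinct ws" "set ws \<subseteq> V" "a \<in> V" "b \<in> V"
    and "a \<noteq> hd ws" "b \<noteq> last ws"
    and "a \<noteq> hd (tl ws @ [b])" "b \<noteq> last (a # butlast ws)"
  shows "\<exists>p. spans (\<Union>(cl ` set ws)) (port (hd ws) a) p (port (last ws) b)"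
  using assms
proof (induction ws arbitrary: a)
  case Nil
  then show ?case by simp
next
  case (Cons w ws)
  show ?case
  proof (cases ws)
    case Nil
    then show ?thesis
      using Cons.prems cluster_path[of w a b] by (auto simp: cl_def)
  next
    case (Cons w' ws')
    have w: "w \<in> V" "w' \<in> V" "w \<noteq> w'" "a \<in> V - {w}" "a \<noteq> w'"
      using Cons.prems Cons by auto
    obtain p where p: "spans (cl w) (port w a) p (port w w')"
      using cluster_path[of w a w'] w by (auto simp: cl_def)
    \<comment> \<open>The next cluster is entered at \<open>port w' w\<close>, so \<open>w\<close>
      takes over the role of \<open>a\<close>.\<close>
    have "\<exists>q. spans (\<Union>(cl ` set ws)) (port (hd ws) w) q (port (last ws) b)"
      using Cons.prems Cons by (intro Cons.IH) (auto split: if_splits simp: neq_Nil_conv hd_append)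
    then obtain q where q: "spans (\<Union>(cl ` set ws)) (port w' w) q (port (last ws) b)"
      using Cons by auto
    have "cl w \<inter> \<Union>(cl ` set ws) = {}"
      using cl_Union_disjoint[of "{w}" "set ws"] Cons.prems by auto
    from hamilton_path_append[OF p q link this] w Cons show ?thesis
      by auto
  qed
qed

text \<open>Since \<open>u\<close> lies outside \<open>S\<close>, the ports towards \<open>u\<close>
  cannot clash with those used between clusters of \<open>S\<close>; hence any ordering of
  \<open>S\<close> from \<open>x\<close> to \<open>y\<close> lifts.\<close>

lemma lift_spanning_path:
  assumes "S \<subseteq> V" "x \<in> S" "y \<in> S" "x \<noteq> y" "u \<in> V - S"
  shows "\<exists>p. spans (\<Union>(cl ` S)) (port x u) p (port y u)"
proof -
  have "finite S"
    using assms(1) finite_V finite_subset by blast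
  then obtain zs where zs: "distinct (x # zs @ [y])" "set (x # zs @ [y]) = S"
    using finite_distinct_list_ends assms by metis
  have "\<exists>p. spans (\<Union>(cl ` set (x # zs @ [y]))) (port (hd (x # zs @ [y])) u) p
      (port (last (x # zs @ [y])) u)"
  proof (rule lift_path)
    show "u \<noteq> hd (tl (x # zs @ [y]) @ [u])" "u \<noteq> last (u # butlast (x # zs @ [y]))"
      using zs assms by (cases zs; auto simp: butlast_append)+
  qed (use zs assms in auto)
  then show ?thesis
    unfolding zs(2) by simp
qed

text \<open>Here \<open>q\<close> is what remains of a path spanning the cluster of \<open>u\<close>
  after its first vertex \<open>port u a\<close> is removed. The end \<open>t\<close> is left open,
  so that both uses of the excursion are covered.\<close>

lemma excursion:
  assumes "S \<subseteq> V" "u \<in> V - S" "a \<in> S" "c \<in> S" "a \<noteq> c"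
    and q: "spans (cl u - {port u a}) (port u c) q t"
  shows "\<exists>p. spans (cl u \<union> \<Union>(cl ` S)) (port u a) p t"
proof -
  obtain r where r: "spans (\<Union>(cl ` S)) (port a u) r (port c u)"
    using lift_spanning_path assms by metis
  have disj: "cl u \<inter> \<Union>(cl ` S) = {}"
    using cl_Union_disjoint[of "{u}" S] assms by auto
  have a: "port u a \<in> cl u"
    using assms by (auto simp: cl_def)
  have "spans ({port u a} \<union> \<Union>(cl ` S)) (port u a) ([port u a] @ r) (port c u)"
    using assms disj a
    by (intro hamilton_path_append[OF hamilton_path_singleton r] link) auto
  moreover have "({port u a} \<union> \<Union>(cl ` S)) \<inter> (cl u - {port u a}) = {}"
    using disj by auto
  moreover have "{port c u, port u c} \<in> E"
    using assms by (intro link) auto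
  ultimately have "spans ({port u a} \<union> \<Union>(cl ` S) \<union> (cl u - {port u a})) (port u a)
      (([port u a] @ r) @ q) t"
    by (intro hamilton_path_append[OF _ q])
  moreover have "{port u a} \<union> \<Union>(cl ` S) \<union> (cl u - {port u a}) = cl u \<union> \<Union>(cl ` S)"
    using a by auto
  ultimately show ?thesis
    by metis
qed

section \<open>The three positions of the two ends\<close>

lemma path_within_cluster:
  assumes "u \<in> V" "a \<in> V - {u}" "b \<in> V - {u}" "a \<noteq> b"
  shows "\<exists>p. spans (\<Union>(cl ` V)) (port u a) p (port u b)"
proof -
  obtain p where p: "spans (cl u) (port u a) p (port u b)"
    using cluster_path assms unfolding cl_def by metis
  have "port u a \<noteq> port u b"
    using assms port_eq_iff[of u a u b] by auto
  from hamilton_path_Cons_cases[OF p this] obtain x q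
    where x: "x \<in> cl u" "x \<noteq> port u a" and q: "spans (cl u - {port u a}) x q (port u b)"
    by metis
  then obtain c where c: "c \<in> V - {u}" "x = port u c" "a \<noteq> c"
    by (auto simp: cl_def)
  \<comment> \<open>The case \<open>c = b\<close> is harmless: the excursion visits all clusters
    other than that of \<open>u\<close>.\<close>
  have "\<exists>p. spans (cl u \<union> \<Union>(cl ` (V - {u}))) (port u a) p (port u b)"
    using assms c q by (intro excursion[of _ _ _ c]) auto
  moreover have "cl u \<union> \<Union>(cl ` (V - {u})) = \<Union>(cl ` V)"
    using assms by auto
  ultimately show ?thesis
    by simp
qed

text \<open>The cluster of \<open>v\<close> is kept for the end: the path leaves the cluster of
  \<open>u\<close> for good at \<open>port u v\<close> and then runs from \<open>port v u\<close> to
  \<open>port v a\<close>.\<close>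

lemma path_same_direction:
  assumes "card V > 3" "u \<in> V" "v \<in> V" "u \<noteq> v" "a \<in> V - {u, v}"
  shows "\<exists>p. spans (\<Union>(cl ` V)) (port u a) p (port v a)"
proof -
  obtain p where p: "spans (cl u) (port u a) p (port u v)"
    using cluster_path[of u a v] assms unfolding cl_def by auto
  have ne: "port u a \<noteq> port u v"
    using assms port_eq_iff[of u a u v] by auto
  from hamilton_path_Cons_cases[OF p ne] obtain x q
    where x: "x \<in> cl u" "x \<noteq> port u a" and q: "spans (cl u - {port u a}) x q (port u v)"
    by metis
  then obtain c where c: "c \<in> V - {u}" "x = port u c" "a \<noteq> c"
    by (auto simp: cl_def)
  \<comment> \<open>The excursion returns from the cluster of \<open>c\<close>, so \<open>c\<close>
    must not be the excluded \<open>v\<close>. Otherwise the distinct path \<open>q\<close> would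
    start and end at \<open>port u v\<close>, the cluster of \<open>u\<close> would have only two
    vertices, and \<open>V\<close> only three.\<close>
  have "c \<noteq> v"
  proof
    assume "c = v"
    with q c have q': "spans (cl u - {port u a}) (port u v) q (port u v)"
      by simp
    then obtain y q1 where q1: "q = y # q1" "y = port u v" "last q = y" "distinct q"
      by (cases q) (simp_all add: hamilton_path_def)
    then have "q1 = []"
      using last_in_set[of q1] by (cases q1) auto
    with q1 q' have sub: "cl u \<subseteq> {port u a, port u v}"
      by (auto simp: hamilton_path_def)
    have "V \<subseteq> {u, a, v}"
    proof
      fix w assume "w \<in> V"
      show "w \<in> {u, a, v}"
      proof (cases "w = u")
        case False
        with \<open>w \<in> V\<close> sub have "port u w = port u a \<or> port u w = port u v"
          by (auto simp: cl_def)
        then show ?thesis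
          using assms False \<open>w \<in> V\<close> by (auto simp: port_eq_iff)
      qed simp
    qed
    then have "card V \<le> card {u, a, v}"
      by (intro card_mono) auto
    also have "\<dots> \<le> 3"
      by (simp add: card_insert_if)
    finally show False
      using assms by simp
  qed
  then have "\<exists>p. spans (cl u \<union> \<Union>(cl ` (V - {u, v}))) (port u a) p (port u v)"
    using assms c q by (intro excursion[of _ _ _ c]) auto
  moreover have "cl u \<union> \<Union>(cl ` (V - {u, v})) = \<Union>(cl ` (V - {v}))"
    using assms by auto
  ultimately obtain r where r: "spans (\<Union>(cl ` (V - {v}))) (port u a) r (port u v)"
    by auto
  obtain s where s: "spans (cl v) (port v u) s (port v a)"
    using cluster_path[of v u a] assms unfolding cl_def by auto
  have "spans (\<Union>(cl ` (V - {v})) \<union> cl v) (port u a) (r @ s) (port v a)"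
    using assms cl_Union_disjoint[of "V - {v}" "{v}"]
    by (intro hamilton_path_append[OF r s] link) auto
  moreover have "\<Union>(cl ` (V - {v})) \<union> cl v = \<Union>(cl ` V)"
    using assms by auto
  ultimately show ?thesis
    by auto
qed

lemma path_between_clusters:
  assumes "card V > 3" "u \<in> V" "v \<in> V" "u \<noteq> v" "a \<in> V - {u}" "b \<in> V - {v}" "a \<noteq> b"
  shows "\<exists>p. spans (\<Union>(cl ` V)) (port u a) p (port v b)"
proof -
  let ?W = "V - {u, v}"
  have W: "finite ?W" "card ?W \<ge> 2"
    using assms finite_V by (auto simp: card_Diff_subset)
  have other: "\<exists>y\<in>?W. y \<noteq> x" for x
  proof (rule ccontr)
    assume "\<not> ?thesis"
    then have "?W \<subseteq> {x}" by auto
    then have "card ?W \<le> card {x}" by (intro card_mono) auto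
    with W show False by simp
  qed
  \<comment> \<open>These become the second and the last but one vertex. If \<open>b\<close> is in
    \<open>?W\<close>, taking \<open>x = b\<close> settles both conditions; otherwise only
    \<open>x \<noteq> a\<close> matters.\<close>
  obtain x y where xy: "x \<in> ?W" "y \<in> ?W" "x \<noteq> y" "x \<noteq> a" "y \<noteq> b"
  proof (cases "b \<in> ?W")
    case True
    with other[of b] assms that show thesis by metis
  next
    case False
    obtain x where "x \<in> ?W" "x \<noteq> a" using other by blast
    moreover obtain y where "y \<in> ?W" "y \<noteq> x" using other by blast
    ultimately show thesis using False that by metis
  qed
  obtain zs where zs: "distinct (x # zs @ [y])" "set (x # zs @ [y]) = ?W"
    using finite_distinct_list_ends[OF W(1) xy(1-3)] by metis
  let ?ws = "u # (x # zs @ [y]) @ [v]"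
  have set_ws: "set ?ws = V"
    using zs(2) assms by auto
  have "\<exists>p. spans (\<Union>(cl ` set ?ws)) (port (hd ?ws) a) p (port (last ?ws) b)"
  proof (rule lift_path)
    show "distinct ?ws"
      using zs assms xy by auto
    show "set ?ws \<subseteq> V"
      using set_ws by simp
    show "b \<noteq> last (a # butlast ?ws)"
      using xy by (simp add: butlast_append)
  qed (use assms xy in auto)
  then show ?thesis
    unfolding set_ws by simp
qed

theorem hamilton_connected_clusters:
  assumes "card V > 3"
  shows "hamilton_connected \<lparr>verts = \<Union>(cl ` V), edges = E\<rparr>"
  unfolding hamilton_connected_def
proof (intro ballI impI)
  fix s t assume "s \<in> verts \<lparr>verts = \<Union>(cl ` V), edges = E\<rparr>"
    and "t \<in> verts \<lparr>verts = \<Union>(cl ` V), edges = E\<rparr>" and "s \<noteq> t"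
  then obtain u a v b where "s = port u a" "u \<in> V" "a \<in> V - {u}" "t = port v b" "v \<in> V" "b \<in> V - {v}"
    "u \<noteq> v \<or> a \<noteq> b"
    by (auto simp: cl_def)
  then show "\<exists>p. spans (\<Union>(cl ` V)) s p t"
    using assms path_within_cluster[of u a b] path_same_direction[of u v a]
      path_between_clusters[of u v a b]
    by (cases "u = v"; cases "a = b") auto
qed

end

section \<open>Truncations of complete graphs as linked clusters\<close>

theorem theorem5p2:
  fixes n :: nat and X :: "'a ugraph" and Y :: "'b ugraph"
    and M :: "'b set set" and F :: "'a set \<Rightarrow> 'b set"
    and lab :: "'b \<Rightarrow> 'a" and con :: "'a \<Rightarrow> 'b ugraph"
  assumes "n > 3"
    and "complete_graph n X"
    and "generalized_truncation X M F lab con Y"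
    and "\<And>v. v \<in> verts X \<Longrightarrow> hamilton_connected (con v)"
  shows "hamilton_connected Y"
proof -
  let ?V = "verts X" and ?E = "M \<union> (\<Union>v\<in>verts X. edges (con v))"
  \<comment> \<open>The ends of \<open>F {u, v}\<close> carry different labels, so the choice is
    forced for adjacent \<open>u\<close> and \<open>v\<close>.\<close>
  define port where "port u v = (SOME x. x \<in> F {u, v} \<and> lab x = u)" for u v
  have fin: "finite ?V" and card: "card ?V = n"
    and edges: "edges X = {e. e \<subseteq> ?V \<and> card e = 2}"
    using assms(2) by (auto simp: complete_graph_def)
  have disj: "pairwise disjnt M" and F: "inj_on F (edges X)" "F ` edges X = M"
    and ends: "\<And>u v. {u, v} \<in> edges X \<Longrightarrow> \<exists>x y. F {u, v} = {x, y} \<and> lab x = u \<and> lab y = v"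
    and con: "\<And>v. v \<in> ?V \<Longrightarrow> verts (con v) = cluster M lab v"
    and Y: "Y = \<lparr>verts = \<Union>M, edges = ?E\<rparr>"
    using assms(3) by (auto simp: generalized_truncation_def matching_def bij_betw_def)
  have edge: "{u, v} \<in> edges X" if "u \<in> ?V" "v \<in> ?V" "u \<noteq> v" for u v
    using that by (simp add: edges)
  have port: "lab (port u v) = u" "F {u, v} = {port u v, port v u}"
    if uv: "u \<in> ?V" "v \<in> ?V" "u \<noteq> v" for u v
  proof -
    obtain x y where xy: "F {u, v} = {x, y}" "lab x = u" "lab y = v"
      using ends[OF edge[OF uv]] by blast
    have "port u v = x"
      unfolding port_def by (rule some_equality) (use xy uv in auto)
    moreover have "port v u = y"
      unfolding port_def by (rule some_equality) (use xy uv in \<open>auto simp: insert_commute\<close>)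
    ultimately show "lab (port u v) = u" "F {u, v} = {port u v, port v u}"
      using xy by auto
  qed
  have F_mem: "F {u, v} \<in> M" if "u \<in> ?V" "v \<in> ?V" "u \<noteq> v" for u v
    using edge[OF that] F by blast
  have F_cases: "\<exists>u v. e = F {u, v} \<and> u \<in> ?V \<and> v \<in> ?V \<and> u \<noteq> v" if "e \<in> M" for e
  proof -
    obtain e' where e': "e' \<in> edges X" "e = F e'" using \<open>e \<in> M\<close> F by blast
    then show ?thesis by (auto simp: edges card_2_iff)
  qed
  have vertex: "\<exists>u v. x = port u v \<and> u \<in> ?V \<and> v \<in> ?V \<and> u \<noteq> v" if x: "x \<in> \<Union>M" for x
  proof -
    from x obtain e where e: "e \<in> M" "x \<in> e" by blast
    from F_cases[OF e(1)] obtain u v where uv: "e = F {u, v}" "u \<in> ?V" "v \<in> ?V" "u \<noteq> v"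
      by blast
    with e(2) port(2)[of u v] have "x = port u v \<or> x = port v u" by auto
    with uv show ?thesis by metis
  qed
  have port_M: "port u v \<in> \<Union>M" if "u \<in> ?V" "v \<in> ?V" "u \<noteq> v" for u v
    using F_mem[OF that] port(2)[OF that] by blast
  have cluster: "cluster M lab u = port u ` (?V - {u})" if "u \<in> ?V" for u
  proof
    show "cluster M lab u \<subseteq> port u ` (?V - {u})"
    proof
      fix x assume "x \<in> cluster M lab u"
      then have x: "x \<in> \<Union>M" "lab x = u"
        unfolding cluster_def by blast+
      from vertex[OF x(1)] obtain u' v where "x = port u' v" "u' \<in> ?V" "v \<in> ?V" "u' \<noteq> v"
        by blast
      with x(2) port(1)[of u' v] show "x \<in> port u ` (?V - {u})"
        by auto
    qed
    show "port u ` (?V - {u}) \<subseteq> cluster M lab u"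
      using that port_M port(1) by (auto simp: cluster_def)
  qed
  \<comment> \<open>The label recovers \<open>u\<close>. A common vertex forces two matching edges
    to coincide, and injectivity of \<open>F\<close> then recovers \<open>v\<close>.\<close>
  have port_inj: "u = u' \<and> v = v'"
    if "u \<in> ?V" "v \<in> ?V" "u \<noteq> v" "u' \<in> ?V" "v' \<in> ?V" "u' \<noteq> v'" "port u v = port u' v'"
    for u v u' v'
  proof -
    have u: "u = u'"
      using port(1)[OF that(1-3)] port(1)[OF that(4-6)] that(7) by simp
    have "\<not> disjnt (F {u, v}) (F {u', v'})"
      using port(2)[OF that(1-3)] port(2)[OF that(4-6)] that(7) by (auto simp: disjnt_def)
    then have "F {u, v} = F {u', v'}"
      using pairwiseD[OF disj F_mem[OF that(1-3)] F_mem[OF that(4-6)]] by blast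
    then have "{u, v} = {u', v'}"
      using inj_onD[OF F(1) _ edge[OF that(1-3)] edge[OF that(4-6)]] by blast
    with u show ?thesis by (auto simp: doubleton_eq_iff)
  qed
  interpret linked_clusters ?V ?E port
  proof
    show "finite ?V" by (fact fin)
    show "port u v = port u' v' \<longleftrightarrow> u = u' \<and> v = v'"
      if "u \<in> ?V" "v \<in> ?V" "u \<noteq> v" "u' \<in> ?V" "v' \<in> ?V" "u' \<noteq> v'" for u v u' v'
      using port_inj[OF that] by blast
    show "{port u v, port v u} \<in> ?E" if "u \<in> ?V" "v \<in> ?V" "u \<noteq> v" for u v
      using F_mem[OF that] port(2)[OF that] by simp
    fix u a b assume u: "u \<in> ?V" and ab: "a \<in> ?V - {u}" "b \<in> ?V - {u}" "a \<noteq> b"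
    have verts: "verts (con u) = port u ` (?V - {u})"
      using con cluster u by simp
    have "port u a \<noteq> port u b"
      using port_inj[of u a u b] u ab by blast
    then obtain p where "hamilton_path (con u) (port u a) p (port u b)"
      using assms(4)[OF u] verts ab unfolding hamilton_connected_def by blast
    from hamilton_path_mono[OF this, of ?E]
    show "\<exists>p. hamilton_path \<lparr>verts = port u ` (?V - {u}), edges = ?E\<rparr> (port u a) p (port u b)"
      using u verts by auto
  qed
  have "\<Union>M = \<Union>(cl ` ?V)"
  proof
    show "\<Union>M \<subseteq> \<Union>(cl ` ?V)"
      using vertex unfolding cl_def by blast
    show "\<Union>(cl ` ?V) \<subseteq> \<Union>M"
      using port_M unfolding cl_def by blast
  qed
  then show ?thesis
    using hamilton_connected_clusters assms(1) card Y by simp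
qed

end
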